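(* Let $(\mathscr{H},d)$ be a Hadamard space that satisfies the $(\overline{Q_4})$ condition, let $C$ be a nonempty, closed and convex subset of $\mathscr{H}$, and let $\mathcal{S}=\{S(t): t\geqslant 0\}$ be a $1$-parameter continuous semigroup of contractions on $C$ with $F(\mathcal{S})\neq\emptyset$. Then for each $x\in C$, the orbit $\{S(t)x\}$ is $\triangle$-mean convergent to a common fixed point of $\mathcal{S}$; that is, there is $p\in F(\mathcal{S})$ such that the Karcher means $\sigma_T(x)$ of the orbit $\{S(t)x\}$ $\triangle$-converge to $p$ as $T\to\infty$.
   Context: A Hadamard space is a complete $CAT(0)$ space. It is uniquely geodesic; $[x,y]$ denotes the geodesic segment between $x$ and $y$. A subset $C$ is convex if $[x,y]\subset C$ for all $x,y\in C$. $(\overline{Q_4})$ condition: for all points $x,y,p,q\in\mathscr{H}$ and every point $m\in[x,y]$, if $d(p,x)\leqslant d(x,q)$ and $d(p,y)\leqslant d(y,q)$, then $d(p,m)\leqslant d(m,q)$. A $1$-parameter continuous semigroup of contractions on $C$ is a family $\mathcal{S}=\{S(t):t\geqslant 0\}$ of self-mappings $S(t):C\to C$ such that: (i) $S(0)x=x$ for $x\in C$; (ii) $S(t+s)x=S(t)S(s)x$ for $x\in C$ and $t,s\geqslant 0$; (iii) $\lim_{t\to t_0}S(t)x=S(t_0)x$ for $x\in C$ and $t,t_0\geqslant 0$; (iv) $d(S(t)x,S(t)y)\leqslant d(x,y)$ for $x,y\in C$ and $t\geqslant 0$. The common fixed point set is $F(\mathcal{S})=\bigcap_{t\geqslant 0}\{x\in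 C: S(t)x=x\}$. $\triangle$-convergence: for a bounded sequence $\{x_n\}$ in $\mathscr{H}$ put $r(x,\{x_n\})=\limsup_{n\to\infty}d(x,x_n)$ and $r(\{x_n\})=\inf_{x\in\mathscr{H}}r(x,\{x_n\})$. The asymptotic center is $A(\{x_n\})=\{x\in\mathscr{H}: r(x,\{x_n\})=r(\{x_n\})\}$, a singleton in a Hadamard space. The sequence $\{x_n\}$ $\triangle$-converges to $x$ if $A(\{x_{n_k}\})=\{x\}$ for every subsequence $\{x_{n_k}\}$ of $\{x_n\}$. A family $c(T)$ of points indexed by $T>0$ $\triangle$-converges to $x$ as $T\to\infty$ if $c(T_n)$ $\triangle$-converges to $x$ for every sequence $T_n\to\infty$. Karcher mean of an orbit: for $T>0$, $\sigma_T(x)$ is the unique minimizer over $y\in\mathscr{H}$ of the function $y\mapsto\frac1T\int_0^T d^2(S(t)x,y)\,dt$. The orbit $\{S(t)x\}$ is called $\triangle$-mean convergent to $p$ if $\sigma_T(x)$ $\triangle$-converges to $p$ as $T\to\infty$. *)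

theory Defs
  imports "HOL-Analysis.Analysis"
begin

text \<open>A geodesic segment joining \<open>x\<close> to \<open>y\<close> is the image of an isometric embedding of an interval.\<close>

definition (in metric_space) geodesic_segment :: "'a \<Rightarrow> 'a \<Rightarrow> 'a set \<Rightarrow> bool" where
  "geodesic_segment x y G \<longleftrightarrow>
     (\<exists>\<gamma> l. 0 \<le> l \<and> \<gamma> 0 = x \<and> \<gamma> l = y \<and>
        (\<forall>s\<in>{0..l}. \<forall>t\<in>{0..l}. dist (\<gamma> s) (\<gamma> t) = \<bar>s - t\<bar>) \<and>
        G = \<gamma> ` {0..l})"

text \<open>Pairs of a point on the side \<open>G\<close> from \<open>p\<close> to \<open>q\<close> of a geodesic triangle and its comparison
  point on the side from \<open>p'\<close> to \<open>q'\<close> of a comparison triangle in the Euclidean plane.\<close>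

definition (in metric_space) comparison_pairs ::
  "'a \<Rightarrow> 'a \<Rightarrow> 'a set \<Rightarrow> real ^ 2 \<Rightarrow> real ^ 2 \<Rightarrow> ('a \<times> (real ^ 2)) set" where
  "comparison_pairs p q G p' q' =
     {(x, x'). x \<in> G \<and> x' \<in> closed_segment p' q' \<and> dist p' x' = dist p x}"

class cat0_space = metric_space +
  assumes geodesic_segment_exists: "\<exists>G. geodesic_segment x y G"
    and cat0_inequality:
      "\<lbrakk>geodesic_segment p q G\<^sub>1; geodesic_segment q r G\<^sub>2; geodesic_segment r p G\<^sub>3;
        dist p' q' = dist p q; dist q' r' = dist q r; dist r' p' = dist r p;
        (x, x') \<in> comparison_pairs p q G\<^sub>1 p' q' \<union> comparison_pairs q r G\<^sub>2 q' r'
                    \<union> comparison_pairs r p G\<^sub>3 r' p';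
        (y, y') \<in> comparison_pairs p q G\<^sub>1 p' q' \<union> comparison_pairs q r G\<^sub>2 q' r'
                    \<union> comparison_pairs r p G\<^sub>3 r' p'\<rbrakk>
       \<Longrightarrow> dist x y \<le> dist x' y'"

class hadamard_space = cat0_space + complete_space

lemma geodesic_segment_unique:
  fixes x y :: "'a::cat0_space"
  assumes G: "geodesic_segment x y G" and H: "geodesic_segment x y H"
  shows "G = H"
proof -
  have sub: "A \<subseteq> B" if A: "geodesic_segment x y A" and B: "geodesic_segment x y B" for A B
  proof
    fix a assume "a \<in> A"
    obtain \<gamma> l where l: "0 \<le> l" "\<gamma> 0 = x" "\<gamma> l = y" "A = \<gamma> ` {0..l}"
      and \<gamma>: "\<And>s t. s \<in> {0..l} \<Longrightarrow> t \<in> {0..l} \<Longrightarrow> dist (\<gamma> s) (\<gamma> t) = \<bar>s - t\<bar>"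
      using A unfolding geodesic_segment_def by metis
    obtain \<delta> k where k: "0 \<le> k" "\<delta> 0 = x" "\<delta> k = y" "B = \<delta> ` {0..k}"
      and \<delta>: "\<And>s t. s \<in> {0..k} \<Longrightarrow> t \<in> {0..k} \<Longrightarrow> dist (\<delta> s) (\<delta> t) = \<bar>s - t\<bar>"
      using B unfolding geodesic_segment_def by metis
    have lk: "l = dist x y" "k = dist x y"
      using \<gamma>[of 0 l] \<delta>[of 0 k] l k by auto
    obtain s where s: "s \<in> {0..l}" "a = \<gamma> s"
      using \<open>a \<in> A\<close> l by auto
    have ds: "dist x a = s" "dist x (\<delta> s) = s" "dist a y = l - s"
      using \<gamma>[of 0 s] \<gamma>[of s l] \<delta>[of 0 s] s l k lk by auto
    have rev: "geodesic_segment y x A"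
      unfolding geodesic_segment_def
    proof (intro exI conjI ballI)
      show "0 \<le> l" "(\<lambda>t. \<gamma> (l - t)) 0 = y" "(\<lambda>t. \<gamma> (l - t)) l = x" using l by auto
      show "dist (\<gamma> (l - u)) (\<gamma> (l - t)) = \<bar>u - t\<bar>" if "u \<in> {0..l}" "t \<in> {0..l}" for u t
        using \<gamma>[of "l - u" "l - t"] that by auto
      have "(\<lambda>t. l - t) ` {0..l} = {0..l}" by simp
      then show "A = (\<lambda>t. \<gamma> (l - t)) ` {0..l}"
        using l by (metis image_image)
    qed
    have deg: "geodesic_segment y y {y}"
      unfolding geodesic_segment_def
      by (rule exI[of _ "\<lambda>_. y"], rule exI[of _ 0]) auto
    define e :: "real ^ 2" where "e = axis 1 1"
    have e: "norm e = 1" by (simp add: e_def)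
    have comp: "s *\<^sub>R e \<in> closed_segment 0 (l *\<^sub>R e)"
    proof (cases "l = 0")
      case True then show ?thesis using s by auto
    next
      case False
      have "s *\<^sub>R e = (1 - s / l) *\<^sub>R 0 + (s / l) *\<^sub>R (l *\<^sub>R e)" using False by simp
      moreover have "0 \<le> s / l" "s / l \<le> 1" using s False by (auto simp: divide_simps)
      ultimately show ?thesis unfolding in_segment by blast
    qed
    have "dist (\<delta> s) a \<le> dist (s *\<^sub>R e) (s *\<^sub>R e)"
    proof (rule cat0_inequality[OF B deg rev, where p' = 0 and q' = "l *\<^sub>R e" and r' = "l *\<^sub>R e"])
      show "dist 0 (l *\<^sub>R e) = dist x y" "dist (l *\<^sub>R e) (l *\<^sub>R e) = dist y y"
        "dist (l *\<^sub>R e) 0 = dist y x"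
        using e l lk by (auto simp: dist_commute)
      show "(\<delta> s, s *\<^sub>R e) \<in> comparison_pairs x y B 0 (l *\<^sub>R e) \<union>
          comparison_pairs y y {y} (l *\<^sub>R e) (l *\<^sub>R e) \<union> comparison_pairs y x A (l *\<^sub>R e) 0"
        using comp ds k lk s e by (auto simp: comparison_pairs_def)
      have "dist (l *\<^sub>R e) (s *\<^sub>R e) = l - s"
        using s e by (simp add: dist_norm flip: scaleR_left_diff_distrib)
      then show "(a, s *\<^sub>R e) \<in> comparison_pairs x y B 0 (l *\<^sub>R e) \<union>
          comparison_pairs y y {y} (l *\<^sub>R e) (l *\<^sub>R e) \<union> comparison_pairs y x A (l *\<^sub>R e) 0"
        using comp ds \<open>a \<in> A\<close>
        by (auto simp: comparison_pairs_def dist_commute closed_segment_commute)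
    qed
    then have "a = \<delta> s" by simp
    then show "a \<in> B" using k lk s by auto
  qed
  show ?thesis using sub[OF G H] sub[OF H G] by blast
qed

text \<open>The segment \<open>[x, y]\<close>; well defined by the preceding lemma.\<close>

definition geod :: "'a::cat0_space \<Rightarrow> 'a \<Rightarrow> 'a set" where
  "geod x y = (THE G. geodesic_segment x y G)"

lemma geodesic_segment_geod: "geodesic_segment x y (geod x y)"
  unfolding geod_def
  by (rule theI') (use geodesic_segment_exists geodesic_segment_unique in blast)

definition geodesically_convex :: "'a::cat0_space set \<Rightarrow> bool" where
  "geodesically_convex C \<longleftrightarrow> (\<forall>x\<in>C. \<forall>y\<in>C. geod x y \<subseteq> C)"

definition Q4_bar :: "'a::cat0_space itself \<Rightarrow> bool" where
  "Q4_bar _ \<longleftrightarrow>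
     (\<forall>(x::'a) y p q. \<forall>m\<in>geod x y.
        dist p x \<le> dist x q \<and> dist p y \<le> dist y q \<longrightarrow> dist p m \<le> dist m q)"

text \<open>Only the values \<open>S t x\<close> with \<open>t \<ge> 0\<close> and \<open>x \<in> C\<close> matter.\<close>

definition contraction_semigroup :: "'a::metric_space set \<Rightarrow> (real \<Rightarrow> 'a \<Rightarrow> 'a) \<Rightarrow> bool" where
  "contraction_semigroup C S \<longleftrightarrow>
     (\<forall>t\<ge>0. S t \<in> C \<rightarrow> C) \<and>
     (\<forall>x\<in>C. S 0 x = x) \<and>
     (\<forall>x\<in>C. \<forall>t\<ge>0. \<forall>s\<ge>0. S (t + s) x = S t (S s x)) \<and>
     (\<forall>x\<in>C. \<forall>t\<^sub>0\<ge>0. ((\<lambda>t. S t x) \<longlongrightarrow> S t\<^sub>0 x) (at t\<^sub>0 within {0..})) \<and>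
     (\<forall>x\<in>C. \<forall>y\<in>C. \<forall>t\<ge>0. dist (S t x) (S t y) \<le> dist x y)"

definition common_fixed_points :: "'a set \<Rightarrow> (real \<Rightarrow> 'a \<Rightarrow> 'a) \<Rightarrow> 'a set" where
  "common_fixed_points C S = (\<Inter>t\<in>{0..}. {x \<in> C. S t x = x})"

text \<open>The asymptotic radii live in \<^typ>\<open>ereal\<close>, where limsup and infimum are total; for
  bounded sequences, the only ones considered, they are finite.\<close>

definition asymp_radius_at :: "'a::metric_space \<Rightarrow> (nat \<Rightarrow> 'a) \<Rightarrow> ereal" where
  "asymp_radius_at x X = limsup (\<lambda>n. ereal (dist x (X n)))"

definition asymp_radius :: "(nat \<Rightarrow> 'a::metric_space) \<Rightarrow> ereal" where
  "asymp_radius X = (INF x. asymp_radius_at x X)"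

definition asymp_center :: "(nat \<Rightarrow> 'a::metric_space) \<Rightarrow> 'a set" where
  "asymp_center X = {x. asymp_radius_at x X = asymp_radius X}"

definition delta_converges :: "(nat \<Rightarrow> 'a::metric_space) \<Rightarrow> 'a \<Rightarrow> bool" where
  "delta_converges X x \<longleftrightarrow>
     bounded (range X) \<and> (\<forall>\<phi>. strict_mono \<phi> \<longrightarrow> asymp_center (X \<circ> \<phi>) = {x})"

definition delta_converges_at_top :: "(real \<Rightarrow> 'a::metric_space) \<Rightarrow> 'a \<Rightarrow> bool" where
  "delta_converges_at_top c x \<longleftrightarrow>
     (\<forall>T. (\<forall>n. 0 < T n) \<and> filterlim T at_top sequentially
        \<longrightarrow> delta_converges (\<lambda>n. c (T n)) x)"

definition karcher_functional :: "(real \<Rightarrow> 'a::metric_space) \<Rightarrow> real \<Rightarrow> 'a \<Rightarrow> real" where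
  "karcher_functional u T y = 1 / T * integral {0..T} (\<lambda>t. (dist (u t) y)\<^sup>2)"

definition karcher_mean :: "(real \<Rightarrow> 'a::metric_space) \<Rightarrow> real \<Rightarrow> 'a" where
  "karcher_mean u T = (THE z. \<forall>y. karcher_functional u T z \<le> karcher_functional u T y)"

definition delta_mean_convergent :: "(real \<Rightarrow> 'a::metric_space) \<Rightarrow> 'a \<Rightarrow> bool" where
  "delta_mean_convergent u p \<longleftrightarrow> delta_converges_at_top (karcher_mean u) p"

end

theory Submission
  imports Defs
begin

text \<open>
  Comparison with a Euclidean triangle makes \<open>y \<mapsto> d\<^sup>2(y, z)\<close> uniformly convex along geodesics, and so
  are the Karcher functional and the squared asymptotic radius: each has a unique minimizer, and a
  point whose value is within \<open>e\<close> of the minimum lies at squared distance at most \<open>2 e\<close> from it.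
  Shifting the orbit by \<open>s\<close> changes the Karcher functional by \<open>O(1 / T)\<close>, hence
  \<open>d(\<sigma>\<^sub>T, S(s) \<sigma>\<^sub>T) \<rightarrow> 0\<close> and every asymptotic centre of a sequence of Karcher means is a common fixed
  point. In the same way \<open>\<sigma>\<^sub>T\<close> approaches every closed convex set that eventually contains the orbit,
  so such a set contains all these centres.

  Let \<open>p \<noteq> q\<close> be two centres, the limit of \<open>d(S(t) x, p)\<close> being at most that of \<open>d(S(t) x, q)\<close>. The
  midpoint \<open>m\<close> of \<open>p\<close> and \<open>q\<close> is then eventually closer to the orbit than \<open>q\<close>. By the \<open>Q\<^sub>4\<close> condition
  the points closer to \<open>m\<close> than to \<open>q\<close> form a closed convex set, so it contains \<open>q\<close>, which forces
  \<open>q = m\<close>, a contradiction.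
\<close>

subsection \<open>Uniform convexity\<close>

text \<open>Place \<open>p\<close> at the origin, \<open>q\<close> at \<open>(a, 0)\<close> and
  \<open>r\<close> at \<open>(s, h)\<close>, where \<open>s\<close> is given by the law of cosines.
  The triangle inequalities amount to |s| \<le> c, so that the height \<open>h\<close> is real. As
  \<open>s\<close> has the denominator \<open>2 * a\<close>, the case \<open>a = 0\<close> is built
  separately.\<close>

lemma comparison_triangle_exists:
  fixes a b c :: real
  assumes "a \<le> b + c" "b \<le> a + c" "c \<le> a + b"
  shows "\<exists>p q r :: real ^ 2. dist p q = a \<and> dist q r = b \<and> dist r p = c"
proof (cases "a = 0")
  case True
  with assms have "b = c" "0 \<le> c" by auto
  then have "dist 0 (0 :: real ^ 2) = a" "dist 0 (axis 1 c :: real ^ 2) = b"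
    "dist (axis 1 c :: real ^ 2) 0 = c"
    using True by (auto simp: dist_norm norm_vec_def L2_set_def sum_2 axis_def)
  then show ?thesis by blast
next
  case False
  have pos: "0 < a" "0 \<le> b" "0 \<le> c" using assms False by auto
  define s where "s = (a\<^sup>2 + c\<^sup>2 - b\<^sup>2) / (2 * a)"
  have "\<bar>a\<^sup>2 + c\<^sup>2 - b\<^sup>2\<bar> \<le> 2 * a * c"
  proof -
    have "b\<^sup>2 \<le> (a + c)\<^sup>2" using assms pos by (intro power_mono) auto
    moreover have "\<bar>a - c\<bar>\<^sup>2 \<le> b\<^sup>2" using assms pos by (intro power_mono) auto
    ultimately show ?thesis by (auto simp: power2_eq_square algebra_simps)
  qed
  then have "\<bar>s\<bar> \<le> c" using pos by (auto simp: s_def abs_mult divide_simps algebra_simps)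
  then have s: "s\<^sup>2 \<le> c\<^sup>2" by (metis abs_ge_zero power2_abs power_mono)
  have as: "2 * a * s = a\<^sup>2 + c\<^sup>2 - b\<^sup>2" using pos by (simp add: s_def)
  define h where "h = sqrt (c\<^sup>2 - s\<^sup>2)"
  have h: "h\<^sup>2 = c\<^sup>2 - s\<^sup>2" using s by (simp add: h_def)
  have "dist (0 :: real ^ 2) (vector [a, 0]) = a"
    "dist (vector [a, 0]) (vector [s, h] :: real ^ 2) = b"
    "dist (vector [s, h] :: real ^ 2) 0 = c"
    using pos h as
    by (auto simp: dist_vec_def L2_set_def sum_2 dist_real_def power2_diff intro!: real_sqrt_unique)
  then show ?thesis by blast
qed

text \<open>The comparison inequality is applied to a point of the side \<open>[x, y]\<close> and
  the opposite vertex \<open>z\<close>; in the plane, the distance from a vertex to a point of the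
  opposite side is given by Stewart's identity.\<close>

lemma geod_point:
  fixes x y :: "'a::cat0_space"
  assumes "0 \<le> t" "t \<le> 1"
  obtains m where "m \<in> geod x y" "dist x m = t * dist x y"
    and "\<And>z. (dist m z)\<^sup>2 \<le> (1 - t) * (dist x z)\<^sup>2 + t * (dist y z)\<^sup>2 - t * (1 - t) * (dist x y)\<^sup>2"
proof -
  obtain \<gamma> l where l: "0 \<le> l" "\<gamma> 0 = x" "\<gamma> l = y" "geod x y = \<gamma> ` {0..l}"
    and \<gamma>: "\<And>s t. s \<in> {0..l} \<Longrightarrow> t \<in> {0..l} \<Longrightarrow> dist (\<gamma> s) (\<gamma> t) = \<bar>s - t\<bar>"
    using geodesic_segment_geod[of x y] unfolding geodesic_segment_def by metis
  define m where "m = \<gamma> (t * l)"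
  have tl: "t * l \<in> {0..l}" using assms l by (auto simp: mult_left_le_one_le)
  have m: "m \<in> geod x y" using tl l by (auto simp: m_def)
  have "l = dist x y" using \<gamma>[of 0 l] l by auto
  then have dm: "dist x m = t * dist x y" using \<gamma>[of 0 "t * l"] tl l by (auto simp: m_def)
  have "(dist m z)\<^sup>2 \<le> (1 - t) * (dist x z)\<^sup>2 + t * (dist y z)\<^sup>2 - t * (1 - t) * (dist x y)\<^sup>2" for z
  proof -
    obtain p q r :: "real ^ 2" where pqr: "dist p q = dist x y" "dist q r = dist y z" "dist r p = dist z x"
      using comparison_triangle_exists[of "dist x y" "dist y z" "dist z x"]
      by (metis add.commute dist_commute dist_triangle)
    define w where "w = (1 - t) *\<^sub>R p + t *\<^sub>R q"
    have w: "w \<in> closed_segment p q" using assms by (auto simp: w_def in_segment)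
    have "dist p w = norm (t *\<^sub>R (p - q))" by (simp add: w_def dist_norm algebra_simps)
    then have "dist p w = t * dist x y" using assms pqr by (simp add: dist_norm)
    then have "(m, w) \<in> comparison_pairs x y (geod x y) p q"
      using w m dm by (simp add: comparison_pairs_def)
    \<comment> \<open>Comparison pairs are points on sides, so the vertex \<open>z\<close> enters as
      the end of \<open>[y, z]\<close>.\<close>
    moreover have "z \<in> geod y z"
      using geodesic_segment_geod[of y z] unfolding geodesic_segment_def by force
    then have "(z, r) \<in> comparison_pairs y z (geod y z) q r"
      using pqr by (simp add: comparison_pairs_def)
    ultimately have "dist m z \<le> dist w r"
      using cat0_inequality[OF geodesic_segment_geod[of x y] geodesic_segment_geod[of y z]
          geodesic_segment_geod[of z x] pqr, of m w z r] by blast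
    then have "(dist m z)\<^sup>2 \<le> (dist w r)\<^sup>2" by (simp add: power_mono)
    \<comment> \<open>Stewart's identity, by expanding the inner products.\<close>
    also have "(dist w r)\<^sup>2 = (1 - t) * (dist r p)\<^sup>2 + t * (dist q r)\<^sup>2 - t * (1 - t) * (dist p q)\<^sup>2"
      unfolding w_def dist_norm power2_norm_eq_inner
      by (simp add: inner_diff_left inner_diff_right inner_add_left inner_add_right inner_commute)
         (simp add: algebra_simps power2_eq_square)
    finally show ?thesis using pqr by (simp add: dist_commute)
  qed
  then show thesis using that m dm by blast
qed

lemma geod_midpoint:
  fixes x y :: "'a::cat0_space"
  obtains m where "m \<in> geod x y" "dist x m = dist x y / 2"
    and "\<And>z. (dist m z)\<^sup>2 \<le> (dist x z)\<^sup>2 / 2 + (dist y z)\<^sup>2 / 2 - (dist x y)\<^sup>2 / 4"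
  by (rule geod_point[of "1/2" x y]) auto

text \<open>Only the constant \<open>1 / 2\<close>, not the optimal \<open>1\<close>, is obtained, as only midpoints are compared.\<close>

lemma midpoint_convex_minimizer:
  fixes f :: "'a::complete_space \<Rightarrow> real"
  assumes "D \<noteq> {}" "closed D" and cont: "continuous_on D f"
    and nonneg: "\<And>y. y \<in> D \<Longrightarrow> 0 \<le> f y"
    and mid: "\<And>x y. x \<in> D \<Longrightarrow> y \<in> D \<Longrightarrow> \<exists>m\<in>D. f m \<le> f x / 2 + f y / 2 - (dist x y)\<^sup>2 / 4"
  obtains z where "z \<in> D" "\<And>y. y \<in> D \<Longrightarrow> f z + (dist z y)\<^sup>2 / 2 \<le> f y"
proof -
  define I where "I = Inf (f ` D)"
  have bdd: "bdd_below (f ` D)" using nonneg by (auto intro!: bdd_belowI[of _ 0])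
  have I: "I \<le> f y" if "y \<in> D" for y
    unfolding I_def using bdd that by (auto intro: cInf_lower)
  have "\<exists>y\<in>D. f y < I + inverse (real (Suc n))" for n
    using cInf_lessD[of "f ` D" "I + inverse (real (Suc n))"] \<open>D \<noteq> {}\<close> by (force simp: I_def)
  then obtain X where X: "\<And>n. X n \<in> D" "\<And>n. f (X n) < I + inverse (real (Suc n))" by metis
  \<comment> \<open>The midpoint has value at least \<open>I\<close>. Applied to two terms of the
    minimizing sequence this gives the Cauchy property; applied to the limit \<open>z\<close> and
    any \<open>y\<close> it gives the final estimate.\<close>
  have close: "(dist x y)\<^sup>2 / 4 \<le> f x / 2 + f y / 2 - I" if "x \<in> D" "y \<in> D" for x y
    using mid[OF that] I by fastforce
  have "Cauchy X"
  proof (rule metric_CauchyI)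
    fix e :: real assume e: "0 < e"
    obtain N where N: "inverse (real (Suc N)) < e\<^sup>2 / 4"
      using reals_Archimedean[of "e\<^sup>2 / 4"] e by auto
    have "dist (X m) (X n) < e" if "m \<ge> N" "n \<ge> N" for m n
    proof -
      have "inverse (real (Suc k)) \<le> inverse (real (Suc N))" if "k \<ge> N" for k
        using that by (simp add: divide_simps)
      from this[of m] this[of n] that have "(dist (X m) (X n))\<^sup>2 < e\<^sup>2"
        using close[OF X(1) X(1), of m n] X(2)[of m] X(2)[of n] N by linarith
      then show ?thesis by (rule power2_less_imp_less) (use e in simp)
    qed
    then show "\<exists>M. \<forall>m\<ge>M. \<forall>n\<ge>M. dist (X m) (X n) < e" by blast
  qed
  then obtain z where z: "X \<longlonglongrightarrow> z" using Cauchy_convergent convergent_def by blast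
  then have zD: "z \<in> D" using \<open>closed D\<close> X(1) closed_sequentially by blast
  have "(\<lambda>n. f (X n)) \<longlonglongrightarrow> f z"
    using continuous_on_tendsto_compose[OF cont z zD] X(1) by simp
  moreover have "(\<lambda>n. I + inverse (real (Suc n))) \<longlonglongrightarrow> I + 0"
    by (intro tendsto_intros LIMSEQ_inverse_real_of_nat)
  ultimately have "f z \<le> I + 0"
    by (rule LIMSEQ_le) (use X(2) less_imp_le in blast)
  then have "f z + (dist z y)\<^sup>2 / 2 \<le> f y" if "y \<in> D" for y
    using close[OF zD that] by simp
  then show thesis using that zD by blast
qed

text \<open>\<open>z\<close> is the point of \<open>D\<close> nearest to \<open>x\<close>. The angle
  at \<open>z\<close> is obtuse: the squares of \<open>dist z x\<close> and \<open>dist z y\<close>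
  add up to at most that of \<open>dist x y\<close>.\<close>

lemma closed_convex_projection:
  fixes x :: "'a::hadamard_space"
  assumes D: "D \<noteq> {}" "closed D" "geodesically_convex D"
  obtains z where "z \<in> D" "\<And>y. y \<in> D \<Longrightarrow> dist z y \<le> dist x y"
proof -
  have "\<exists>m\<in>D. (dist m x)\<^sup>2 \<le> (dist a x)\<^sup>2 / 2 + (dist b x)\<^sup>2 / 2 - (dist a b)\<^sup>2 / 4"
    if "a \<in> D" "b \<in> D" for a b
    using geod_midpoint[of a b] D(3) that unfolding geodesically_convex_def by (metis subsetD)
  then obtain z where z: "z \<in> D" "\<And>y. y \<in> D \<Longrightarrow> (dist z x)\<^sup>2 + (dist z y)\<^sup>2 / 2 \<le> (dist y x)\<^sup>2"
    using midpoint_convex_minimizer[of D "\<lambda>y. (dist y x)\<^sup>2"] D(1,2)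
      continuous_on_power[OF continuous_on_dist[OF continuous_on_id continuous_on_const]]
    by (metis zero_le_power2)
  have "dist z y \<le> dist x y" if y: "y \<in> D" for y
  proof -
    \<comment> \<open>The minimizer supplies only half of the square of \<open>dist z y\<close>,
      which would cost a factor sqrt 2. Comparing \<open>z\<close> with points of
      \<open>[z, y]\<close> at parameter \<open>t\<close> and letting \<open>t\<close> tend to 0
      recovers the full square.\<close>
    have le: "(dist z x)\<^sup>2 \<le> (dist y x)\<^sup>2 - (1 - t) * (dist z y)\<^sup>2" if t: "0 < t" "t < 1" for t
    proof -
      obtain m where m: "m \<in> geod z y"
        "(dist m x)\<^sup>2 \<le> (1 - t) * (dist z x)\<^sup>2 + t * (dist y x)\<^sup>2 - t * (1 - t) * (dist z y)\<^sup>2"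
        using geod_point[of t z y] t by (metis less_imp_le)
      have "m \<in> D" using m z y D(3) unfolding geodesically_convex_def by blast
      then have "(dist z x)\<^sup>2 \<le> (dist m x)\<^sup>2"
        using z(2)[of m] zero_le_power2[of "dist z m"] by linarith
      from order_trans[OF this m(2)] have "t * (dist z x)\<^sup>2 \<le> t * ((dist y x)\<^sup>2 - (1 - t) * (dist z y)\<^sup>2)"
        by (simp add: algebra_simps)
      then show ?thesis using t by simp
    qed
    have "((\<lambda>t. (dist y x)\<^sup>2 - (1 - t) * (dist z y)\<^sup>2) \<longlongrightarrow> (dist y x)\<^sup>2 - (1 - 0) * (dist z y)\<^sup>2)
        (at_right 0)"
      by (intro tendsto_intros)
    moreover have "eventually (\<lambda>t. (dist z x)\<^sup>2 \<le> (dist y x)\<^sup>2 - (1 - t) * (dist z y)\<^sup>2) (at_right 0)"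
      using eventually_at_right_less[of "0::real"] eventually_at_rightI[of 0 1 "\<lambda>t. t < (1::real)"] le
      by (auto elim: eventually_elim2)
    ultimately have "(dist z x)\<^sup>2 \<le> (dist y x)\<^sup>2 - (1 - 0) * (dist z y)\<^sup>2"
      by (intro tendsto_lowerbound[where F = "at_right (0::real)"]) auto
    then have "(dist z y)\<^sup>2 \<le> (dist x y)\<^sup>2"
      using zero_le_power2[of "dist z x"] unfolding dist_commute[of y x] diff_0_right mult_1 by linarith
    then show ?thesis by (rule power2_le_imp_le) simp
  qed
  then show thesis using that z by blast
qed

subsection \<open>Asymptotic centres\<close>

text \<open>Serves to replace extended-real limsup arithmetic by eventual real inequalities.\<close>

lemma asymp_radius_at_le_iff:
  "asymp_radius_at x X \<le> ereal r \<longleftrightarrow> (\<forall>e>0. eventually (\<lambda>n. dist x (X n) < r + e) sequentially)"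
proof -
  have "asymp_radius_at x X \<le> ereal r \<longleftrightarrow>
      (\<forall>y>ereal r. eventually (\<lambda>n. ereal (dist x (X n)) < y) sequentially)"
    unfolding asymp_radius_at_def by (rule Limsup_le_iff)
  also have "\<dots> \<longleftrightarrow> (\<forall>e>0. eventually (\<lambda>n. dist x (X n) < r + e) sequentially)"
  proof (intro iffI allI impI)
    fix e :: real
    assume "\<forall>y>ereal r. eventually (\<lambda>n. ereal (dist x (X n)) < y) sequentially" "0 < e"
    then show "eventually (\<lambda>n. dist x (X n) < r + e) sequentially"
      by (auto dest!: spec[of _ "ereal (r + e)"])
  next
    fix y :: ereal
    assume ev: "\<forall>e>0. eventually (\<lambda>n. dist x (X n) < r + e) sequentially" and "ereal r < y"
    then show "eventually (\<lambda>n. ereal (dist x (X n)) < y) sequentially"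
    proof (cases y)
      case (real s)
      then show ?thesis using ev[rule_format, of "s - r"] \<open>ereal r < y\<close> by simp
    qed auto
  qed
  finally show ?thesis .
qed

lemma asymp_radius_at_real:
  assumes "bounded (range X)"
  obtains r where "0 \<le> r" "asymp_radius_at x X = ereal r"
proof -
  obtain K where K: "\<And>n. dist x (X n) \<le> K"
    using assms by (auto simp: bounded_any_center[of _ x])
  then have "asymp_radius_at x X \<le> ereal K"
    unfolding asymp_radius_at_le_iff by (auto intro!: always_eventually le_less_trans[OF K])
  moreover have "0 \<le> asymp_radius_at x X"
    unfolding asymp_radius_at_def by (rule le_Limsup) auto
  ultimately show thesis using that by (cases "asymp_radius_at x X") auto
qed

text \<open>The midpoint inequality for the squared distances to \<open>X n\<close> passes to the
  limsup, so the squared radius \<open>R\<close> has a unique minimizer; it is continuous because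
  \<open>R\<close> is 1-Lipschitz.\<close>

lemma asymp_center_singleton:
  fixes X :: "nat \<Rightarrow> 'a::hadamard_space"
  assumes "bounded (range X)"
  obtains z where "asymp_center X = {z}"
proof -
  have "\<exists>r. 0 \<le> r \<and> asymp_radius_at y X = ereal r" for y
    using asymp_radius_at_real[OF assms] by metis
  then obtain R where R: "\<And>y. 0 \<le> R y" "\<And>y. asymp_radius_at y X = ereal (R y)" by metis
  have R_le: "R y \<le> r \<longleftrightarrow> (\<forall>e>0. eventually (\<lambda>n. dist y (X n) < r + e) sequentially)" for y r
    using asymp_radius_at_le_iff[of y X r] R(2) by simp
  have ev: "eventually (\<lambda>n. dist y (X n) < R y + e) sequentially" if "0 < e" for y e
    using R_le[of y "R y"] that by blast
  have lip: "R y \<le> R x + dist y x" for x y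
    unfolding R_le
  proof (intro allI impI)
    fix e :: real assume "0 < e"
    show "eventually (\<lambda>n. dist y (X n) < R x + dist y x + e) sequentially"
      using ev[OF \<open>0 < e\<close>, of x]
    proof eventually_elim
      case (elim n)
      then show ?case using dist_triangle[of y "X n" x] by simp
    qed
  qed
  have "1-lipschitz_on UNIV R"
  proof (rule lipschitz_onI)
    show "dist (R x) (R y) \<le> 1 * dist x y" for x y
      using lip[of x y] lip[of y x] by (simp add: dist_real_def dist_commute abs_le_iff)
  qed simp
  then have cont: "continuous_on UNIV (\<lambda>y. (R y)\<^sup>2)"
    by (intro continuous_on_power lipschitz_on_continuous_on)
  have mid: "\<exists>m\<in>UNIV. (R m)\<^sup>2 \<le> (R x)\<^sup>2 / 2 + (R y)\<^sup>2 / 2 - (dist x y)\<^sup>2 / 4" for x y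
  proof -
    obtain m where m: "\<And>z. (dist m z)\<^sup>2 \<le> (dist x z)\<^sup>2 / 2 + (dist y z)\<^sup>2 / 2 - (dist x y)\<^sup>2 / 4"
      using geod_midpoint by metis
    \<comment> \<open>Both distances exceed their limsup by less than \<open>e\<close> eventually;
      the slack is removed afterwards by letting \<open>e\<close> tend to 0.\<close>
    have le: "(R m)\<^sup>2 \<le> (R x + e)\<^sup>2 / 2 + (R y + e)\<^sup>2 / 2 - (dist x y)\<^sup>2 / 4" (is "_ \<le> ?c")
      if "0 < e" for e
    proof -
      have ev': "eventually (\<lambda>n. (dist m (X n))\<^sup>2 \<le> ?c) sequentially"
        using ev[OF that, of x] ev[OF that, of y]
      proof eventually_elim
        case (elim n)
        then have "(dist x (X n))\<^sup>2 \<le> (R x + e)\<^sup>2" "(dist y (X n))\<^sup>2 \<le> (R y + e)\<^sup>2"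
          by (simp_all add: power_mono)
        then show ?case using m[of "X n"] by simp
      qed
      \<comment> \<open>\<open>?c\<close> bounds a square at some index, so taking its square root
        and squaring again is harmless.\<close>
      then have "0 \<le> ?c"
        by (metis (no_types, lifting) eventually_sequentially order_trans order_refl zero_le_power2)
      have "R m \<le> sqrt ?c"
        unfolding R_le using ev' by (auto elim!: eventually_mono dest: real_le_rsqrt)
      then have "(R m)\<^sup>2 \<le> (sqrt ?c)\<^sup>2" using R(1) by (intro power_mono)
      then show ?thesis using \<open>0 \<le> ?c\<close> by simp
    qed
    have "((\<lambda>e. (R x + e)\<^sup>2 / 2 + (R y + e)\<^sup>2 / 2 - (dist x y)\<^sup>2 / 4) \<longlongrightarrow>
        (R x + 0)\<^sup>2 / 2 + (R y + 0)\<^sup>2 / 2 - (dist x y)\<^sup>2 / 4) (at_right 0)"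
      by (intro tendsto_intros) auto
    moreover have "eventually (\<lambda>e. (R m)\<^sup>2 \<le> (R x + e)\<^sup>2 / 2 + (R y + e)\<^sup>2 / 2 - (dist x y)\<^sup>2 / 4)
        (at_right 0)"
      using eventually_at_right_less[of "0::real"] by (auto elim: eventually_mono intro: le)
    ultimately have "(R m)\<^sup>2 \<le> (R x + 0)\<^sup>2 / 2 + (R y + 0)\<^sup>2 / 2 - (dist x y)\<^sup>2 / 4"
      by (intro tendsto_lowerbound[where F = "at_right (0::real)"]) auto
    then show ?thesis by auto
  qed
  obtain z where z: "\<And>y. (R z)\<^sup>2 + (dist z y)\<^sup>2 / 2 \<le> (R y)\<^sup>2"
    using midpoint_convex_minimizer[OF _ closed_UNIV cont _ mid] by auto
  have Rz: "R z \<le> R y" for y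
  proof -
    have "(R z)\<^sup>2 \<le> (R y)\<^sup>2" using z[of y] zero_le_power2[of "dist z y"] by linarith
    then show ?thesis by (rule power2_le_imp_le[OF _ R(1)])
  qed
  have rad: "asymp_radius X = ereal (R z)"
    unfolding asymp_radius_def R(2) by (intro antisym INF_lower INF_greatest) (simp_all add: Rz)
  have "y = z" if "R y = R z" for y
    using z[of y] that by simp
  then have "asymp_center X = {z}" by (auto simp: asymp_center_def rad R(2))
  then show thesis using that by blast
qed

text \<open>Such a \<open>y\<close> attains the asymptotic radius as well, and only one point does.
  Both the membership and the fixed point property of centres are obtained from this
  criterion.\<close>

lemma asymp_center_eqI:
  assumes "bounded (range X)" and center: "asymp_center X = {q}"
    and near: "\<And>e. 0 < e \<Longrightarrow> eventually (\<lambda>n. dist y (X n) \<le> dist q (X n) + e) sequentially"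
  shows "y = q"
proof -
  obtain r where r: "asymp_radius_at q X = ereal r"
    using asymp_radius_at_real[OF assms(1)] by blast
  have "asymp_radius_at y X \<le> ereal r"
    unfolding asymp_radius_at_le_iff
  proof (intro allI impI)
    fix e :: real assume "0 < e"
    then have "eventually (\<lambda>n. dist q (X n) < r + e / 2) sequentially"
      using asymp_radius_at_le_iff[of q X r] r by simp
    moreover have "eventually (\<lambda>n. dist y (X n) \<le> dist q (X n) + e / 2) sequentially"
      using near[of "e / 2"] \<open>0 < e\<close> by simp
    ultimately show "eventually (\<lambda>n. dist y (X n) < r + e) sequentially"
      by eventually_elim simp
  qed
  also have "ereal r = asymp_radius X" using center r by (auto simp: asymp_center_def)
  finally have "y \<in> asymp_center X"
    by (auto simp: asymp_center_def asymp_radius_def intro!: antisym INF_lower)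
  then show ?thesis using center by simp
qed

subsection \<open>Karcher means\<close>

text \<open>Integrating the midpoint inequality over time shows that the functional is uniformly
  convex. The quadratic gap makes the minimizer unique, which justifies the definite description,
  and turns near-minimality into nearness.\<close>

lemma karcher_mean_minimizes:
  fixes u :: "real \<Rightarrow> 'a::hadamard_space"
  assumes u: "continuous_on {0..T} u" and T: "0 < T"
  shows "karcher_functional u T (karcher_mean u T) + (dist (karcher_mean u T) y)\<^sup>2 / 2
    \<le> karcher_functional u T y"
proof -
  let ?\<phi> = "karcher_functional u T"
  have int: "(\<lambda>t. (dist (u t) y)\<^sup>2) integrable_on {0..T}" for y
    by (intro integrable_continuous_real continuous_intros u)
  have "continuous_on (UNIV \<times> cbox 0 T) (\<lambda>(y, t). (dist (u t) y)\<^sup>2)"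
    unfolding case_prod_unfold
    by (intro continuous_intros continuous_on_compose2[OF u]) auto
  then have "continuous_on UNIV (\<lambda>y. integral (cbox 0 T) (\<lambda>t. (dist (u t) y)\<^sup>2))"
    by (rule integral_continuous_on_param)
  then have cont: "continuous_on UNIV ?\<phi>"
    unfolding karcher_functional_def by (intro continuous_intros) auto
  have nonneg: "0 \<le> ?\<phi> y" for y
    using T integral_nonneg[OF int] by (simp add: karcher_functional_def)
  have mid: "\<exists>m\<in>UNIV. ?\<phi> m \<le> ?\<phi> a / 2 + ?\<phi> b / 2 - (dist a b)\<^sup>2 / 4" for a b
  proof -
    obtain m where m: "\<And>z. (dist z m)\<^sup>2 \<le> (dist z a)\<^sup>2 / 2 + (dist z b)\<^sup>2 / 2 - (dist a b)\<^sup>2 / 4"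
      using geod_midpoint[of a b] by (metis dist_commute)
    have "((\<lambda>t. (dist (u t) a)\<^sup>2 / 2 + (dist (u t) b)\<^sup>2 / 2 - (dist a b)\<^sup>2 / 4) has_integral
       integral {0..T} (\<lambda>t. (dist (u t) a)\<^sup>2) / 2 + integral {0..T} (\<lambda>t. (dist (u t) b)\<^sup>2) / 2
        - (T - 0) * ((dist a b)\<^sup>2 / 4)) {0..T}"
      using T has_integral_const_real[of "(dist a b)\<^sup>2 / 4" 0 T]
      by (intro has_integral_diff has_integral_add has_integral_divide integrable_integral int) simp_all
    then have "integral {0..T} (\<lambda>t. (dist (u t) m)\<^sup>2) \<le>
       integral {0..T} (\<lambda>t. (dist (u t) a)\<^sup>2) / 2 + integral {0..T} (\<lambda>t. (dist (u t) b)\<^sup>2) / 2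
        - T * ((dist a b)\<^sup>2 / 4)"
      using m by (intro has_integral_le[OF integrable_integral[OF int]]) simp_all
    then have "?\<phi> m \<le> ?\<phi> a / 2 + ?\<phi> b / 2 - (dist a b)\<^sup>2 / 4"
      using T unfolding karcher_functional_def by (simp add: field_simps)
    then show ?thesis by blast
  qed
  obtain z where z: "\<And>y. ?\<phi> z + (dist z y)\<^sup>2 / 2 \<le> ?\<phi> y"
    using midpoint_convex_minimizer[OF _ closed_UNIV cont nonneg mid] by auto
  have "karcher_mean u T = z"
    unfolding karcher_mean_def
  proof (rule the_equality)
    show "\<forall>y. ?\<phi> z \<le> ?\<phi> y" using z by (smt (verit) zero_le_power2 divide_nonneg_pos)
    show "a = z" if "\<forall>y. ?\<phi> a \<le> ?\<phi> y" for a
    proof -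
      have "(dist z a)\<^sup>2 \<le> 0" using z[of a] that[rule_format, of z] by linarith
      then show "a = z" by simp
    qed
  qed
  then show ?thesis using z by simp
qed

text \<open>Isolates the cost of an initial time interval, which becomes negligible after division
  by \<open>T\<close>.\<close>

lemma integral_initial_part_le:
  fixes f :: "real \<Rightarrow> real"
  assumes f: "continuous_on {0..T} f" and "0 \<le> a" "a \<le> T" and K: "\<And>t. t \<in> {0..a} \<Longrightarrow> f t \<le> K"
  shows "integral {0..T} f \<le> a * K + integral {a..T} f"
proof -
  have "integral {0..T} f = integral {0..a} f + integral {a..T} f"
    using assms by (intro Henstock_Kurzweil_Integration.integral_combine[symmetric] integrable_continuous_real) auto
  moreover have "integral {0..a} f \<le> integral {0..a} (\<lambda>_. K)"
    using assms by (intro integral_le integrable_continuous_real continuous_on_subset[OF f]) auto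
  ultimately show ?thesis using assms by simp
qed

text \<open>The only point at which the \<open>Q4_bar\<close> condition is unfolded; everything else
  holds in any Hadamard space until half-spaces are needed.\<close>

lemma Q4_bar_halfspace_convex:
  fixes p q :: "'a::cat0_space"
  assumes "Q4_bar TYPE('a)"
  shows "geodesically_convex {z. dist p z \<le> dist z q}"
  using assms unfolding Q4_bar_def geodesically_convex_def by blast

lemma common_fixed_points_iff:
  "p \<in> common_fixed_points C S \<longleftrightarrow> p \<in> C \<and> (\<forall>t\<ge>0. S t p = p)"
  by (auto simp: common_fixed_points_def)

subsection \<open>Orbits of contraction semigroups\<close>

text \<open>\<open>w\<close> witnesses that common fixed points exist and is the reference point of
  all bounds: the orbit never leaves the ball of radius \<open>dist x w\<close> about it.\<close>

locale semigroup_orbit =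
  fixes C :: "'a::hadamard_space set" and S :: "real \<Rightarrow> 'a \<Rightarrow> 'a" and x w :: 'a
  assumes closed: "closed C" and convex: "geodesically_convex C"
    and semigroup: "contraction_semigroup C S"
    and x: "x \<in> C" and w: "w \<in> common_fixed_points C S"
begin

abbreviation "F \<equiv> common_fixed_points C S"
abbreviation "\<sigma> \<equiv> karcher_mean (\<lambda>t. S t x)"

lemma S_in: "0 \<le> t \<Longrightarrow> y \<in> C \<Longrightarrow> S t y \<in> C"
  using semigroup by (auto simp: contraction_semigroup_def)

lemma S_contraction: "0 \<le> t \<Longrightarrow> y \<in> C \<Longrightarrow> z \<in> C \<Longrightarrow> dist (S t y) (S t z) \<le> dist y z"
  using semigroup by (auto simp: contraction_semigroup_def)

lemma S_add: "0 \<le> t \<Longrightarrow> 0 \<le> s \<Longrightarrow> y \<in> C \<Longrightarrow> S (t + s) y = S t (S s y)"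
  using semigroup by (auto simp: contraction_semigroup_def)

lemma dist_S_fixed: "0 \<le> t \<Longrightarrow> y \<in> C \<Longrightarrow> p \<in> F \<Longrightarrow> dist (S t y) p \<le> dist y p"
  using S_contraction[of t y p] by (auto simp: common_fixed_points_iff)

lemma orbit_continuous: "continuous_on {0..} (\<lambda>t. S t x)"
  using semigroup x by (auto simp: contraction_semigroup_def continuous_on_def)

lemma orbit_continuous_dist: "0 \<le> a \<Longrightarrow> continuous_on {a..b} (\<lambda>t. (dist (S t x) y)\<^sup>2)"
  by (intro continuous_intros continuous_on_subset[OF orbit_continuous]) auto

lemma orbit_dist_fixed_antimono:
  assumes "p \<in> F" "0 \<le> s" "s \<le> t"
  shows "dist (S t x) p \<le> dist (S s x) p"
  using S_add[of "t - s" s x] dist_S_fixed[of "t - s" "S s x" p] S_in[of s x] x assms by simp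

section \<open>Karcher means of the orbit\<close>

text \<open>Form of the minimizer estimate for integrals not divided by \<open>T\<close>; the factor
  2 undoes the constant 1/2 of \<open>karcher_mean_minimizes\<close>.\<close>

lemma karcher_mean_dist_le:
  assumes "0 < T" "T * e \<ge> integral {0..T} (\<lambda>t. (dist (S t x) y)\<^sup>2)
      - integral {0..T} (\<lambda>t. (dist (S t x) (\<sigma> T))\<^sup>2)"
  shows "(dist (\<sigma> T) y)\<^sup>2 \<le> 2 * e"
proof -
  have "(dist (\<sigma> T) y)\<^sup>2 / 2 \<le> karcher_functional (\<lambda>t. S t x) T y - karcher_functional (\<lambda>t. S t x) T (\<sigma> T)"
    using karcher_mean_minimizes[of T "\<lambda>t. S t x" y] assms(1)
      continuous_on_subset[OF orbit_continuous, of "{0..T}"] by auto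
  also have "\<dots> = (integral {0..T} (\<lambda>t. (dist (S t x) y)\<^sup>2)
      - integral {0..T} (\<lambda>t. (dist (S t x) (\<sigma> T))\<^sup>2)) / T"
    by (simp add: karcher_functional_def diff_divide_distrib)
  also have "\<dots> \<le> e" using assms by (simp add: divide_simps mult.commute)
  finally show ?thesis by simp
qed

text \<open>\<open>w\<close> competes with the mean, and its functional value is at most the square
  of \<open>dist x w\<close>.\<close>

lemma karcher_mean_bounded:
  assumes "0 < T"
  shows "dist (\<sigma> T) w \<le> 2 * dist x w"
proof -
  have "integral {0..T} (\<lambda>t. (dist (S t x) w)\<^sup>2) \<le> integral {0..T} (\<lambda>t. (dist x w)\<^sup>2)"
    using dist_S_fixed[OF _ x w]
    by (intro integral_le integrable_continuous_real orbit_continuous_dist power_mono) auto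
  moreover have "0 \<le> integral {0..T} (\<lambda>t. (dist (S t x) (\<sigma> T))\<^sup>2)"
    by (intro integral_nonneg integrable_continuous_real orbit_continuous_dist) auto
  ultimately have "(dist (\<sigma> T) w)\<^sup>2 \<le> 2 * (dist x w)\<^sup>2"
    using assms by (intro karcher_mean_dist_le) auto
  \<comment> \<open>The factor sqrt 2 is rounded up to 2.\<close>
  also have "\<dots> \<le> (2 * dist x w)\<^sup>2" by (simp add: power_mult_distrib)
  finally show ?thesis by (rule power2_le_imp_le) simp
qed

text \<open>\<open>z\<close> is the projection of the mean to \<open>D\<close>. It is no farther
  than the mean from the orbit after time \<open>a\<close>, so passing to it can raise the integral
  only on \<open>[0, a]\<close>.\<close>

lemma karcher_mean_dist_projection:
  assumes D: "closed D" "geodesically_convex D" and a: "0 \<le> a" "a \<le> T" "0 < T"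
    and tail: "\<And>t. a \<le> t \<Longrightarrow> S t x \<in> D"
  obtains z where "z \<in> D" "(dist (\<sigma> T) z)\<^sup>2 \<le> 2 * (a * (5 * dist x w)\<^sup>2) / T"
proof -
  have "D \<noteq> {}" using tail[of a] by auto
  then obtain z where z: "z \<in> D" "\<And>y. y \<in> D \<Longrightarrow> dist z y \<le> dist (\<sigma> T) y"
    using closed_convex_projection[OF _ D] by blast
  have orb: "dist (S t x) w \<le> dist x w" if "0 \<le> t" for t
    using dist_S_fixed[OF that x w] .
  \<comment> \<open>With \<open>d = dist x w\<close>: \<open>S t x\<close> and \<open>S a x\<close>
    are within \<open>2 * d\<close>, and \<open>z\<close> is no farther from \<open>S a x\<close>
    than the mean, hence within \<open>2 * d + d\<close>.\<close>
  have "dist (S t x) z \<le> 5 * dist x w" if "0 \<le> t" for t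
    using z(2)[OF tail[of a]] orb[OF that] orb[OF a(1)] karcher_mean_bounded[OF a(3)]
      dist_triangle[of "S t x" z "S a x"] dist_triangle2[of "S t x" "S a x" w]
      dist_triangle2[of "\<sigma> T" "S a x" w] by (simp add: dist_commute)
  then have "integral {0..T} (\<lambda>t. (dist (S t x) z)\<^sup>2)
      \<le> a * (5 * dist x w)\<^sup>2 + integral {a..T} (\<lambda>t. (dist (S t x) z)\<^sup>2)"
    using a by (intro integral_initial_part_le orbit_continuous_dist power_mono) auto
  also have "integral {a..T} (\<lambda>t. (dist (S t x) z)\<^sup>2) \<le> integral {a..T} (\<lambda>t. (dist (S t x) (\<sigma> T))\<^sup>2)"
    using z(2)[OF tail] a
    by (intro integral_le integrable_continuous_real orbit_continuous_dist power_mono)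
       (auto simp: dist_commute)
  also have "\<dots> \<le> integral {0..T} (\<lambda>t. (dist (S t x) (\<sigma> T))\<^sup>2)"
    using a by (intro integral_subset_le integrable_continuous_real orbit_continuous_dist) auto
  finally have "(dist (\<sigma> T) z)\<^sup>2 \<le> 2 * (a * (5 * dist x w)\<^sup>2 / T)"
    using a by (intro karcher_mean_dist_le) auto
  then show thesis using that z(1) by simp
qed

text \<open>With \<open>D = C\<close> and \<open>a = 0\<close> the error of the projection estimate
  vanishes.\<close>

lemma karcher_mean_in:
  assumes "0 < T"
  shows "\<sigma> T \<in> C"
proof -
  obtain z where "z \<in> C" "(dist (\<sigma> T) z)\<^sup>2 \<le> 2 * (0 * (5 * dist x w)\<^sup>2) / T"
    using karcher_mean_dist_projection[OF closed convex order_refl less_imp_le[OF assms] assms S_in[OF _ x]]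
    by blast
  then show ?thesis by simp
qed

text \<open>\<open>S s\<close> moves the mean and the orbit points together without increasing
  distances, so after a time shift the integral for \<open>S s (\<sigma> T)\<close> exceeds the
  minimal one at most by its part over \<open>[0, s]\<close>.\<close>

lemma karcher_mean_almost_fixed:
  assumes s: "0 \<le> s" "s \<le> T" "0 < T"
  shows "(dist (\<sigma> T) (S s (\<sigma> T)))\<^sup>2 \<le> 2 * (s * (5 * dist x w)\<^sup>2) / T"
proof -
  let ?z = "S s (\<sigma> T)" and ?f = "\<lambda>t. (dist (S t x) (\<sigma> T))\<^sup>2"
  \<comment> \<open>Through \<open>w\<close> the distance is at most
    \<open>dist x w + 2 * dist x w\<close>; the larger factor 5 matches the bound for
    projections.\<close>
  have "dist (S t x) ?z \<le> 5 * dist x w" if "0 \<le> t" for t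
    using dist_S_fixed[OF that x w] dist_S_fixed[OF s(1) karcher_mean_in[OF s(3)] w]
      karcher_mean_bounded[OF s(3)] dist_triangle2[of "S t x" ?z w] zero_le_dist[of x w] by linarith
  then have "integral {0..T} (\<lambda>t. (dist (S t x) ?z)\<^sup>2)
      \<le> s * (5 * dist x w)\<^sup>2 + integral {s..T} (\<lambda>t. (dist (S t x) ?z)\<^sup>2)"
    using s by (intro integral_initial_part_le orbit_continuous_dist power_mono) auto
  also have "integral {s..T} (\<lambda>t. (dist (S t x) ?z)\<^sup>2) = integral {0..T - s} (\<lambda>t. (dist (S (t + s) x) ?z)\<^sup>2)"
    using integral_shift[of 0 s "T - s" "\<lambda>t. (dist (S t x) ?z)\<^sup>2"] orbit_continuous_dist[OF s(1)]
    by (simp add: o_def)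
  also have "\<dots> \<le> integral {0..T - s} ?f"
  proof (intro integral_le integrable_continuous_real orbit_continuous_dist order_refl)
    show "continuous_on {0..T - s} (\<lambda>t. (dist (S (t + s) x) ?z)\<^sup>2)"
      using s by (intro continuous_intros continuous_on_compose2[OF orbit_continuous]) auto
    show "(dist (S (t + s) x) ?z)\<^sup>2 \<le> ?f t" if "t \<in> {0..T - s}" for t
      using S_contraction[OF s(1), of "S t x" "\<sigma> T"] S_add[of s t x] S_in[of t x] x s that
        karcher_mean_in by (auto simp: add.commute intro: power_mono)
  qed
  also have "\<dots> \<le> integral {0..T} ?f"
    using s by (intro integral_subset_le integrable_continuous_real orbit_continuous_dist) auto
  finally have "(dist (\<sigma> T) ?z)\<^sup>2 \<le> 2 * (s * (5 * dist x w)\<^sup>2 / T)"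
    using s by (intro karcher_mean_dist_le) auto
  then show ?thesis by simp
qed

lemma karcher_mean_seq_bounded:
  assumes "\<And>n. 0 < T n"
  shows "bounded (range (\<lambda>n. \<sigma> (T n)))"
  using karcher_mean_bounded[OF assms]
  by (auto simp: bounded_any_center[of _ w] dist_commute)

section \<open>Asymptotic centres of sequences of Karcher means\<close>

context
  fixes T :: "nat \<Rightarrow> real" and q
  assumes T: "\<And>n. 0 < T n" "filterlim T at_top sequentially"
    and center: "asymp_center (\<lambda>n. \<sigma> (T n)) = {q}"
begin

lemma eventually_dist_karcher_mean_less:
  assumes "\<And>n. a \<le> T n \<Longrightarrow> (dist (\<sigma> (T n)) (z n))\<^sup>2 \<le> B / T n" and "0 < e"
  shows "eventually (\<lambda>n. dist (\<sigma> (T n)) (z n) < e) sequentially"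
proof -
  have "eventually (\<lambda>n. a \<le> T n) sequentially" "eventually (\<lambda>n. B / e\<^sup>2 < T n) sequentially"
    using T(2) filterlim_at_top filterlim_at_top_dense by blast+
  then show ?thesis
  proof eventually_elim
    case (elim n)
    then have "B / T n < e\<^sup>2" using \<open>0 < e\<close> T(1)[of n] by (simp add: field_simps)
    with assms(1)[OF elim(1)] have "(dist (\<sigma> (T n)) (z n))\<^sup>2 < e\<^sup>2" by linarith
    then show ?case by (rule power2_less_imp_less) (use \<open>0 < e\<close> in simp)
  qed
qed

text \<open>The means approach points \<open>z n\<close> of \<open>D\<close>, and the projection
  \<open>y\<close> of \<open>q\<close> to \<open>D\<close> is no farther than \<open>q\<close> from
  each \<open>z n\<close>. So \<open>y\<close> is asymptotically as near to the means as the centre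
  and coincides with it.\<close>

lemma center_in_eventual_convex:
  assumes D: "closed D" "geodesically_convex D" and a: "0 \<le> a"
    and tail: "\<And>t. a \<le> t \<Longrightarrow> S t x \<in> D"
  shows "q \<in> D"
proof -
  have "D \<noteq> {}" using tail[of a] by auto
  then obtain y where y: "y \<in> D" "\<And>z. z \<in> D \<Longrightarrow> dist y z \<le> dist q z"
    using closed_convex_projection[OF _ D] by blast
  have "\<exists>z\<in>D. a \<le> T n \<longrightarrow> (dist (\<sigma> (T n)) z)\<^sup>2 \<le> 2 * (a * (5 * dist x w)\<^sup>2) / T n" for n
    using karcher_mean_dist_projection[OF D a _ T(1) tail, of n] y(1) by metis
  then obtain z where z: "\<And>n. z n \<in> D"
    "\<And>n. a \<le> T n \<Longrightarrow> (dist (\<sigma> (T n)) (z n))\<^sup>2 \<le> 2 * (a * (5 * dist x w)\<^sup>2) / T n"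
    by metis
  have "y = q"
  proof (rule asymp_center_eqI[OF karcher_mean_seq_bounded[OF T(1)] center])
    fix e :: real assume "0 < e"
    then have "eventually (\<lambda>n. dist (\<sigma> (T n)) (z n) < e / 2) sequentially"
      by (intro eventually_dist_karcher_mean_less[OF z(2)]) auto
    then show "eventually (\<lambda>n. dist y (\<sigma> (T n)) \<le> dist q (\<sigma> (T n)) + e) sequentially"
    proof eventually_elim
      case (elim n)
      then show ?case
        using y(2)[OF z(1)[of n]] dist_triangle2[of y "\<sigma> (T n)" "z n"]
          dist_triangle[of q "z n" "\<sigma> (T n)"] by linarith
    qed
  qed
  then show ?thesis using y(1) by simp
qed

text \<open>\<open>S s q\<close> is no farther from \<open>S s (\<sigma> (T n))\<close> than
  \<open>q\<close> is from \<open>\<sigma> (T n)\<close>, and these two points merge as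
  \<open>n\<close> grows.\<close>

lemma center_in_F: "q \<in> F"
proof -
  have q: "q \<in> C"
    using center_in_eventual_convex[OF closed convex order_refl] S_in x by auto
  have "S s q = q" if s: "0 \<le> s" for s
  proof (rule asymp_center_eqI[OF karcher_mean_seq_bounded[OF T(1)] center])
    fix e :: real assume "0 < e"
    then have "eventually (\<lambda>n. dist (\<sigma> (T n)) (S s (\<sigma> (T n))) < e) sequentially"
      using eventually_dist_karcher_mean_less[OF karcher_mean_almost_fixed[OF s _ T(1)]] by blast
    then show "eventually (\<lambda>n. dist (S s q) (\<sigma> (T n)) \<le> dist q (\<sigma> (T n)) + e) sequentially"
    proof eventually_elim
      case (elim n)
      then show ?case
        using S_contraction[OF s q karcher_mean_in[OF T(1)], of n]
          dist_triangle2[of "S s q" "\<sigma> (T n)" "S s (\<sigma> (T n))"] by linarith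
    qed
  qed
  then show ?thesis using q by (simp add: common_fixed_points_iff)
qed

text \<open>The half-space of points at least as close to \<open>p\<close> as to \<open>q\<close>
  contains a tail of the orbit, hence also \<open>q\<close>, whose distance to itself is 0.\<close>

lemma center_eq_of_eventually_closer:
  assumes Q4: "Q4_bar TYPE('a)" and "0 \<le> a"
    and "\<And>t. a \<le> t \<Longrightarrow> dist p (S t x) \<le> dist (S t x) q"
  shows "q = p"
proof -
  have "q \<in> {z. dist p z \<le> dist z q}"
    using assms(3)
    by (intro center_in_eventual_convex[OF _ Q4_bar_halfspace_convex[OF Q4] \<open>0 \<le> a\<close>]
        closed_Collect_le continuous_intros) auto
  then show ?thesis by simp
qed

end

section \<open>Uniqueness of the centre\<close>

text \<open>For a common fixed point \<open>p\<close> the distance is nonincreasing along the orbit,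
  so the infimum is its limit.\<close>

definition "limit_dist p = (INF t\<in>{0..}. dist (S t x) p)"

lemma limit_dist_le: "0 \<le> t \<Longrightarrow> limit_dist p \<le> dist (S t x) p"
  unfolding limit_dist_def by (rule cINF_lower) (auto intro: bdd_belowI2[of _ 0])

lemma limit_dist_eventually:
  assumes "p \<in> F" "0 < e"
  obtains a where "0 \<le> a" "\<And>t. a \<le> t \<Longrightarrow> (dist (S t x) p)\<^sup>2 < (limit_dist p)\<^sup>2 + e"
proof -
  have nonneg: "0 \<le> limit_dist p" unfolding limit_dist_def by (rule cINF_greatest) auto
  then have "limit_dist p < sqrt ((limit_dist p)\<^sup>2 + e)"
    using \<open>0 < e\<close> by (intro real_less_rsqrt) simp
  then obtain a where a: "0 \<le> a" "dist (S a x) p < sqrt ((limit_dist p)\<^sup>2 + e)"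
    using cInf_lessD[of "(\<lambda>t. dist (S t x) p) ` {0..}"] unfolding limit_dist_def by fastforce
  have "(dist (S t x) p)\<^sup>2 < (limit_dist p)\<^sup>2 + e" if "a \<le> t" for t
  proof -
    have "dist (S t x) p < sqrt ((limit_dist p)\<^sup>2 + e)"
      using orbit_dist_fixed_antimono[OF assms(1) a(1) that] a(2) by simp
    then have "(dist (S t x) p)\<^sup>2 < (sqrt ((limit_dist p)\<^sup>2 + e))\<^sup>2"
      by (intro power_strict_mono) auto
    then show ?thesis using \<open>0 < e\<close> by (simp add: add_nonneg_nonneg)
  qed
  then show thesis using that a(1) by blast
qed

text \<open>Asymmetric form: \<open>q\<close> is a centre, while \<open>p\<close> is any common
  fixed point that is asymptotically no farther from the orbit.\<close>

lemma centers_eq_of_limit_dist_le: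
  assumes Q4: "Q4_bar TYPE('a)"
    and "p \<in> F" "limit_dist p \<le> limit_dist q"
    and T: "\<And>n. 0 < T n" "filterlim T at_top sequentially"
    and center: "asymp_center (\<lambda>n. \<sigma> (T n)) = {q}"
  shows "p = q"
proof (rule ccontr)
  assume "p \<noteq> q"
  \<comment> \<open>The gain in the midpoint inequality; it pays exactly for the two errors
    \<open>e / 2\<close> made in replacing the squared distances by their limits.\<close>
  define e where "e = (dist p q)\<^sup>2 / 4"
  have e: "0 < e" using \<open>p \<noteq> q\<close> by (simp add: e_def)
  have nonneg: "0 \<le> limit_dist y" for y
    unfolding limit_dist_def by (rule cINF_greatest) auto
  have q: "q \<in> F" by (rule center_in_F[OF T center])
  obtain m where m: "dist p m = dist p q / 2"
    "\<And>z. (dist m z)\<^sup>2 \<le> (dist p z)\<^sup>2 / 2 + (dist q z)\<^sup>2 / 2 - e"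
    unfolding e_def using geod_midpoint[of p q] by metis
  obtain a where a: "0 \<le> a" "\<And>t. a \<le> t \<Longrightarrow> (dist (S t x) p)\<^sup>2 < (limit_dist p)\<^sup>2 + e"
    using limit_dist_eventually[OF \<open>p \<in> F\<close> e] by blast
  obtain b where b: "0 \<le> b" "\<And>t. b \<le> t \<Longrightarrow> (dist (S t x) q)\<^sup>2 < (limit_dist q)\<^sup>2 + e"
    using limit_dist_eventually[OF q e] by blast
  have "dist m (S t x) \<le> dist (S t x) q" if "max a b \<le> t" for t
  proof -
    have "(limit_dist p)\<^sup>2 \<le> (limit_dist q)\<^sup>2"
      using assms(3) nonneg by (intro power_mono)
    then have "(dist m (S t x))\<^sup>2 \<le> (limit_dist q)\<^sup>2"
      using m(2)[of "S t x"] a(2)[of t] b(2)[of t] that by (simp add: dist_commute)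
    then have "dist m (S t x) \<le> limit_dist q"
      using nonneg by (rule power2_le_imp_le)
    then show ?thesis using limit_dist_le[of t q] a that by simp
  qed
  then have "q = m"
    using center_eq_of_eventually_closer[OF T center Q4, of "max a b"] a by auto
  then show False using m(1) \<open>p \<noteq> q\<close> by simp
qed

text \<open>One of the two limit distances is the smaller, so the asymmetric form applies to the
  centres in one order or the other.\<close>

lemma centers_eq:
  assumes "Q4_bar TYPE('a)"
    and "\<And>n. 0 < T n" "filterlim T at_top sequentially" "asymp_center (\<lambda>n. \<sigma> (T n)) = {p}"
    and "\<And>n. 0 < U n" "filterlim U at_top sequentially" "asymp_center (\<lambda>n. \<sigma> (U n)) = {q}"
  shows "p = q"
proof (cases "limit_dist p \<le> limit_dist q")
  case True
  then show ?thesis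
    using centers_eq_of_limit_dist_le[OF assms(1) _ _ assms(5-7), of p] center_in_F[OF assms(2-4)] by blast
next
  case False
  then show ?thesis
    using centers_eq_of_limit_dist_le[OF assms(1) _ _ assms(2-4), of q] center_in_F[OF assms(5-7)] by fastforce
qed

lemma orbit_delta_mean_convergent:
  assumes Q4: "Q4_bar TYPE('a)"
  shows "\<exists>p\<in>F. delta_mean_convergent (\<lambda>t. S t x) p"
proof -
  \<comment> \<open>Any sequence tending to infinity could define \<open>p\<close>;
    \<open>Suc\<close> keeps the times positive.\<close>
  define N where "N n = real (Suc n)" for n
  have N: "0 < N n" "filterlim N at_top sequentially" for n
    using filterlim_compose[OF filterlim_real_sequentially filterlim_Suc] by (auto simp: N_def[abs_def])
  obtain p where p: "asymp_center (\<lambda>n. \<sigma> (N n)) = {p}"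
    by (rule asymp_center_singleton[OF karcher_mean_seq_bounded[of N, OF N(1)]])
  have "delta_converges (\<lambda>n. \<sigma> (T n)) p"
    if T: "\<And>n. 0 < T n" "filterlim T at_top sequentially" for T
    unfolding delta_converges_def
  proof (intro conjI allI impI)
    show "bounded (range (\<lambda>n. \<sigma> (T n)))" by (rule karcher_mean_seq_bounded[of T, OF T(1)])
    fix \<phi> :: "nat \<Rightarrow> nat" assume \<phi>: "strict_mono \<phi>"
    \<comment> \<open>A subsequence of means is again a sequence of means at times tending to
      infinity, so its centre is the same point \<open>p\<close>.\<close>
    define U where "U n = T (\<phi> n)" for n
    have U: "0 < U n" "filterlim U at_top sequentially" for n
      using T(1) filterlim_compose[OF T(2) filterlim_subseq[OF \<phi>]] by (auto simp: U_def[abs_def])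
    obtain q where q: "asymp_center (\<lambda>n. \<sigma> (U n)) = {q}"
      by (rule asymp_center_singleton[OF karcher_mean_seq_bounded[of U, OF U(1)]])
    have "p = q" by (rule centers_eq[OF Q4 N p U q])
    then show "asymp_center ((\<lambda>n. \<sigma> (T n)) \<circ> \<phi>) = {p}" using q by (simp add: o_def U_def)
  qed
  then have "delta_mean_convergent (\<lambda>t. S t x) p"
    by (simp add: delta_mean_convergent_def delta_converges_at_top_def)
  then show ?thesis using center_in_F[OF N p] by blast
qed

end

theorem theorem3p5:
  fixes C :: "'a::hadamard_space set"
    and S :: "real \<Rightarrow> 'a \<Rightarrow> 'a"
  assumes "Q4_bar TYPE('a)"
    and "C \<noteq> {}" and "closed C" and "geodesically_convex C"
    and "contraction_semigroup C S"
    and "common_fixed_points C S \<noteq> {}"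
  shows "\<forall>x\<in>C. \<exists>p\<in>common_fixed_points C S. delta_mean_convergent (\<lambda>t. S t x) p"
proof
  fix x assume "x \<in> C"
  obtain w where "w \<in> common_fixed_points C S" using assms by blast
  then interpret semigroup_orbit C S x w
    using assms \<open>x \<in> C\<close> by unfold_locales
  show "\<exists>p\<in>common_fixed_points C S. delta_mean_convergent (\<lambda>t. S t x) p"
    by (rule orbit_delta_mean_convergent[OF assms(1)])
qed

end
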